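(* Suppose $f:\mathbb R\to[0,\infty)$ is continuous and of bounded variation, and $0<p_1<p_2\le\infty$. Then $$\mathbf{ucat}^{p_1}(f)\le\mathbf{ucat}^{p_2}(f).$$
   Context: A continuous function $u:X\to[0,\infty)$ on a topological space is unimodal if there is $M>0$ such that the superlevel set $u^{-1}[c,\infty)$ is contractible for $0<c\le M$ and empty for $c>M$. For $p\in(0,\infty)$, the unimodal $p$-category $\mathbf{ucat}^p(f)$ of $f:X\to[0,\infty)$ is the minimum number $n$ of unimodal functions $u_1,\dots,u_n:X\to[0,\infty)$ such that pointwise $f=\left(\sum_{i=1}^n u_i^p\right)^{1/p}$; $\mathbf{ucat}^\infty(f)$ is the minimum number $n$ of unimodal functions such that pointwise $f=\max_{1\le i\le n}u_i$. The value is $\infty$ if no such $n$ exists. (For $f\equiv 0$ the value is $0$.) Bounded variation means that $\sup\sum_{i=1}^k|f(t_i)-f(t_{i-1})|<\infty$, the supremum being over all finite sequences $t_0<\dots<t_k$ in $\mathbb R$. *)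

theory Defs
  imports "HOL-Analysis.Analysis"
begin

text \<open>Nonemptiness is required explicitly because the library's
  \<^const>\<open>contractible\<close> holds for the empty set, whereas a contractible space
  is conventionally nonempty; so \<open>M\<close> is the attained maximum of \<open>u\<close>.\<close>

definition unimodal :: "('a::topological_space \<Rightarrow> real) \<Rightarrow> bool" where
  "unimodal u \<longleftrightarrow> continuous_on UNIV u \<and> (\<forall>x. 0 \<le> u x) \<and>
     (\<exists>M>0. (\<forall>c. 0 < c \<and> c \<le> M \<longrightarrow> {x. c \<le> u x} \<noteq> {} \<and> contractible {x. c \<le> u x}) \<and>
            (\<forall>c>M. {x. c \<le> u x} = {}))"

text \<open>The combination of \<open>u 0, \<dots>, u (n - 1)\<close> is meant for nonnegative functions and
  \<open>p \<in> (0, \<infinity>]\<close>. For \<open>n = 0\<close> it is the zero function, so that the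
  zero function has category \<open>0\<close>.\<close>

definition lp_combination :: "ennreal \<Rightarrow> nat \<Rightarrow> (nat \<Rightarrow> 'a \<Rightarrow> real) \<Rightarrow> 'a \<Rightarrow> real" where
  "lp_combination p n u x =
     (if n = 0 then 0
      else if p = \<infinity> then (MAX i\<in>{..<n}. u i x)
      else (\<Sum>i<n. u i x powr enn2real p) powr (1 / enn2real p))"

definition ucat :: "ennreal \<Rightarrow> ('a::topological_space \<Rightarrow> real) \<Rightarrow> enat" where
  "ucat p f = Inf {enat n | n. \<exists>u. (\<forall>i<n. unimodal (u i)) \<and> (\<forall>x. f x = lp_combination p n u x)}"

definition bounded_variation :: "(real \<Rightarrow> real) \<Rightarrow> bool" where
  "bounded_variation f \<longleftrightarrow>
     bdd_above {\<Sum>i=1..k. \<bar>f (t i) - f (t (i - 1))\<bar> | (k::nat) (t :: nat \<Rightarrow> real).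
                  strict_mono_on {0..k} t}"

end

theory Submission
  imports Defs
begin

text \<open>
  On the real line a unimodal function increases up to a mode and decreases after it. Write
  \<open>f\<close> as a \<open>p\<^sub>2\<close>-combination of \<open>n\<close> unimodal functions \<open>u i\<close>, and let \<open>M\<close> be a finite set
  with one mode of each. It suffices to write \<open>g = f powr p\<^sub>1\<close> as an ordinary sum of functions with one mode
  each, one for every point of \<open>M\<close>: the powers \<open>1 / p\<^sub>1\<close> of the nonzero summands are unimodal and
  form a \<open>p\<^sub>1\<close>-combination equal to \<open>f\<close>.

  Left of all modes \<open>g\<close> increases, and right of all modes it decreases. Between two neighbouring
  modes \<open>a < b\<close>, each \<open>u i\<close> is either decreasing (mode at most \<open>a\<close>) or increasing (mode at least
  \<open>b\<close>). Let \<open>D\<close> be the \<open>p\<^sub>1\<close>-th power of the \<open>p\<^sub>2\<close>-combination of the decreasing ones alone. Then \<open>D\<close>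
  decreases and \<open>0 \<le> D \<le> g\<close>. The point where \<open>p\<^sub>1 < p\<^sub>2\<close> enters is that \<open>g - D\<close> increases
  (\<open>increment_lp_combination_on_Un_le\<close>): for \<open>p\<^sub>2 < \<infinity>\<close> this is the concavity of \<open>x powr (p\<^sub>1 / p\<^sub>2)\<close>,
  which makes the loss caused by a decreasing summand smaller when another summand is added, and for
  \<open>p\<^sub>2 = \<infinity>\<close> the maximum has the same property. So the total descent of \<open>g\<close> on \<open>[a, b]\<close> is at most
  \<open>D a - D b \<le> g a\<close>, the value with which \<open>g\<close> enters the gap.

  These bounds on the descent suffice for a decomposition with modes in \<open>M\<close>
  (\<open>sum_of_single_peaks\<close>). At each mode \<open>a\<close> the peaks up to \<open>a\<close> together carry all of \<open>g a\<close>;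
  in the gap \<open>[a, b]\<close> they absorb the descent of \<open>D\<close>, while a new peak with mode \<open>b\<close> starts from \<open>0\<close>
  and absorbs the rise of \<open>g - D\<close>. The argument is an induction that splits off the rightmost peak.
\<close>

section \<open>Functions with a single peak\<close>

definition peak_at :: "real \<Rightarrow> (real \<Rightarrow> real) \<Rightarrow> bool" where
  "peak_at m u \<longleftrightarrow> continuous_on UNIV u \<and> (\<forall>x. 0 \<le> u x) \<and>
     (\<forall>x y. x \<le> y \<and> y \<le> m \<longrightarrow> u x \<le> u y) \<and> (\<forall>x y. m \<le> x \<and> x \<le> y \<longrightarrow> u y \<le> u x)"

text \<open>A contractible subset of the line is an interval, so a superlevel set containing a maximum
  point \<open>m\<close> and \<open>x\<close> contains everything between them.\<close>

lemma unimodal_imp_peak_at: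
  fixes u :: "real \<Rightarrow> real"
  assumes "unimodal u"
  obtains m where "peak_at m u"
proof -
  from assms obtain M where cont: "continuous_on UNIV u" and nn: "\<And>x. 0 \<le> u x" and M: "M > 0"
    and lev: "\<And>c. 0 < c \<Longrightarrow> c \<le> M \<Longrightarrow> {x. c \<le> u x} \<noteq> {} \<and> contractible {x. c \<le> u x}"
    and above: "\<And>c. c > M \<Longrightarrow> {x. c \<le> u x} = {}"
    unfolding unimodal_def by blast
  obtain m where m: "M \<le> u m" using lev[of M] M by auto
  have le: "u x \<le> M" for x using above[of "u x"] by force
  have between: "u x \<le> u y" if "x \<le> y \<and> y \<le> m \<or> m \<le> y \<and> y \<le> x" for x y
  proof (cases "u x = 0")
    case False
    then have "0 < u x" using nn[of x] by simp
    then have "connected {z. u x \<le> u z}"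
      using lev[of "u x"] le[of x] contractible_imp_connected by blast
    moreover have "x \<in> {z. u x \<le> u z}" "m \<in> {z. u x \<le> u z}" using m le[of x] by auto
    ultimately have "y \<in> {z. u x \<le> u z}" using that by (meson connectedD_interval)
    then show ?thesis by simp
  qed (simp add: nn)
  have "peak_at m u"
    unfolding peak_at_def using cont nn between by blast
  then show thesis by (rule that)
qed

lemma peak_at_imp_unimodal:
  assumes u: "peak_at m u" and pos: "0 < u m"
  shows "unimodal u"
proof -
  have up: "\<And>x y. x \<le> y \<Longrightarrow> y \<le> m \<Longrightarrow> u x \<le> u y" and down: "\<And>x y. m \<le> x \<Longrightarrow> x \<le> y \<Longrightarrow> u y \<le> u x"
    using u unfolding peak_at_def by blast+
  have max: "u x \<le> u m" for x using up[of x m] down[of m x] by linarith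
  have "is_interval {x. c \<le> u x}" for c
    unfolding is_interval_1
  proof (intro ballI allI impI)
    fix a b x assume "a \<in> {x. c \<le> u x}" "b \<in> {x. c \<le> u x}" "a \<le> x \<and> x \<le> b"
    then show "x \<in> {x. c \<le> u x}" using up[of a x] down[of x b] by force
  qed
  then have "contractible {x. c \<le> u x}" for c
    by (simp add: convex_imp_contractible is_interval_convex)
  moreover have "{x. c \<le> u x} \<noteq> {}" if "c \<le> u m" for c using that by auto
  moreover have "{x. c \<le> u x} = {}" if "c > u m" for c using max that by (auto simp: not_le intro: le_less_trans)
  ultimately show ?thesis
    using u pos unfolding unimodal_def peak_at_def by blast
qed

lemma continuous_on_powr_const:
  fixes f :: "'a::topological_space \<Rightarrow> real"
  assumes "continuous_on A f" "\<And>x. x \<in> A \<Longrightarrow> 0 \<le> f x" "0 < r"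
  shows "continuous_on A (\<lambda>x. f x powr r)"
  using assms by (intro continuous_on_powr') auto

lemma peak_at_powr:
  assumes "peak_at m u" "0 < r"
  shows "peak_at m (\<lambda>x. u x powr r)"
  using assms unfolding peak_at_def
  by (auto intro!: continuous_on_powr_const powr_mono2)

section \<open>Splitting a function into single peaks\<close>

text \<open>A decreasing \<open>D\<close> that is at least as steep in its descent as \<open>g\<close>; it bounds the total descent of
  \<open>g\<close> on \<open>[a, b]\<close> by \<open>D a - D b \<le> g a\<close>.\<close>

definition absorbs_descent :: "(real \<Rightarrow> real) \<Rightarrow> real \<Rightarrow> real \<Rightarrow> (real \<Rightarrow> real) \<Rightarrow> bool" where
  "absorbs_descent g a b D \<longleftrightarrow> continuous_on UNIV D \<and> (\<forall>x. 0 \<le> D x) \<and> D a \<le> g a \<and>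
     (\<forall>x y. a \<le> x \<and> x \<le> y \<and> y \<le> b \<longrightarrow> D y \<le> D x \<and> g x - D x \<le> g y - D y)"

text \<open>The induction step: \<open>g\<close> is split into a peak \<open>v\<close> at the last mode \<open>b\<close> and a remainder \<open>h\<close>
  that agrees with \<open>g\<close> up to the previous mode \<open>a\<close> and decreases from there on. On \<open>[a, b]\<close> the
  remainder follows the descent of \<open>D\<close> and \<open>v\<close> takes the rise of \<open>g - D\<close>; to the right of \<open>b\<close>,
  where \<open>g\<close> decreases, both follow \<open>g\<close> in the proportion that they have at \<open>b\<close>.\<close>

lemma split_off_last_peak:
  assumes cont: "continuous_on UNIV g" and nn: "\<And>x. 0 \<le> g x" and "a < b"
    and down: "\<And>x y. b \<le> x \<Longrightarrow> x \<le> y \<Longrightarrow> g y \<le> g x"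
    and D: "absorbs_descent g a b D"
  obtains h v where "continuous_on UNIV h" "\<And>x. 0 \<le> h x" "\<And>x. x \<le> a \<Longrightarrow> h x = g x"
    "\<And>x y. a \<le> x \<Longrightarrow> x \<le> y \<Longrightarrow> h y \<le> h x" "peak_at b v" "\<And>x. g x = h x + v x"
proof -
  have contD: "continuous_on UNIV D" and nnD: "\<And>x. 0 \<le> D x" and Da: "D a \<le> g a"
    and Ddown: "\<And>x y. a \<le> x \<Longrightarrow> x \<le> y \<Longrightarrow> y \<le> b \<Longrightarrow> D y \<le> D x"
    and Dup: "\<And>x y. a \<le> x \<Longrightarrow> x \<le> y \<Longrightarrow> y \<le> b \<Longrightarrow> g x - D x \<le> g y - D y"
    using D unfolding absorbs_descent_def by blast+
  \<comment> \<open>\<open>E\<close> is the remainder up to \<open>b\<close>, extended by a constant; \<open>D\<close> is raised so as to start at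
    \<open>g a\<close>, which makes the new peak start at \<open>0\<close>. The factor \<open>\<rho>\<close> is the decay of \<open>g\<close> after \<open>b\<close>;
    if \<open>g b = 0\<close>, then \<open>g\<close>, and with it \<open>E\<close>, vanishes from \<open>b\<close> on, and \<open>1\<close> keeps \<open>\<rho>\<close> continuous.\<close>
  define E where "E x = g (min x a) + D (max a (min x b)) - D a" for x
  define \<rho> where "\<rho> x = (if g b = 0 then 1 else g (max x b) / g b)" for x
  define h where "h x = E x * \<rho> x" for x
  define v where "v x = (g (min x b) - E x) * \<rho> x" for x
  have contc: "continuous_on UNIV (\<lambda>x. k (l x))"
    if "continuous_on UNIV k" "continuous_on UNIV l" for k l :: "real \<Rightarrow> real"
    using continuous_on_compose2[OF that] by simp
  have contE: "continuous_on UNIV E"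
    unfolding E_def by (intro continuous_intros contc[OF cont] contc[OF contD])
  have cont\<rho>: "continuous_on UNIV \<rho>"
    unfolding \<rho>_def by (cases "g b = 0") (auto intro!: continuous_intros contc[OF cont])
  have E_left: "E x = g x" if "x \<le> a" for x
    using that \<open>a < b\<close> by (simp add: E_def min_def max_def)
  have E_mid: "E x = g a + D x - D a" if "a \<le> x" "x \<le> b" for x
    using that by (auto simp: E_def min_def max_def)
  have E_right: "E x = E b" if "b \<le> x" for x
    using that \<open>a < b\<close> by (simp add: E_def min_def max_def)
  have E_down: "E y \<le> E x" if "a \<le> x" "x \<le> y" for x y
    using that \<open>a < b\<close> Ddown[of "min x b" "min y b"] by (simp add: E_def max_def)
  have nnE: "0 \<le> E x" for x
  proof (cases "x \<le> a")
    case False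
    then show ?thesis using Da nnD[of "max a (min x b)"] by (simp add: E_def)
  qed (simp add: E_left nn)
  have rho_left: "\<rho> x = 1" if "x \<le> b" for x
    using that by (simp add: \<rho>_def max_def)
  have nn\<rho>: "0 \<le> \<rho> x" for x by (simp add: \<rho>_def nn)
  have rho_down: "\<rho> y \<le> \<rho> x" if "x \<le> y" for x y
    using that down[of "max x b" "max y b"] nn[of b]
    by (auto simp: \<rho>_def intro!: divide_right_mono)
  have g_rho: "g x = g (min x b) * \<rho> x" for x
  proof (cases "x \<le> b")
    case False
    then show ?thesis using down[of b x] nn[of x] by (auto simp: \<rho>_def min_def max_def)
  qed (simp add: rho_left)
  have v_left: "v x = 0" if "x \<le> a" for x
    using that \<open>a < b\<close> by (simp add: v_def E_left)
  have v_mid: "v x = (g x - D x) - (g a - D a)" if "a \<le> x" "x \<le> b" for x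
    using that by (simp add: v_def E_mid rho_left)
  have v_right: "v x = v b * \<rho> x" if "b \<le> x" for x
    using that by (simp add: v_def E_right[of x] rho_left)
  have nnv_mid: "0 \<le> v x" if "a \<le> x" "x \<le> b" for x
    using that Dup[of a x] by (simp add: v_mid)
  have nnvb: "0 \<le> v b" using nnv_mid \<open>a < b\<close> by simp
  have nnv: "0 \<le> v x" for x
    using v_left[of x] nnv_mid[of x] v_right[of x] nnvb nn\<rho>[of x]
    by (metis linorder_linear mult_nonneg_nonneg order_refl)
  have v_up: "v x \<le> v y" if "x \<le> y" "y \<le> b" for x y
  proof (cases "x \<le> a")
    case False
    then show ?thesis using that Dup[of x y] by (simp add: v_mid)
  qed (simp add: v_left nnv)
  have v_down: "v y \<le> v x" if "b \<le> x" "x \<le> y" for x y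
    using that v_right[of x] v_right[of y] rho_down[of x y] nnvb by (simp add: mult_left_mono)
  show thesis
  proof (rule that)
    show "continuous_on UNIV h" unfolding h_def by (intro continuous_intros contE cont\<rho>)
    show "0 \<le> h x" for x by (simp add: h_def nnE nn\<rho>)
    show "h x = g x" if "x \<le> a" for x using that \<open>a < b\<close> by (simp add: h_def E_left rho_left)
    show "h y \<le> h x" if "a \<le> x" "x \<le> y" for x y
      unfolding h_def using that by (intro mult_mono E_down rho_down nnE nn\<rho>)
    have "continuous_on UNIV v"
      unfolding v_def by (intro continuous_intros contE cont\<rho> contc[OF cont])
    then show "peak_at b v" unfolding peak_at_def using nnv v_up v_down by blast
    show "g x = h x + v x" for x
      using g_rho[of x] by (simp add: h_def v_def algebra_simps)
  qed
qed

text \<open>Induction on the number of modes, removing the largest one. The remainder left by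
  \<open>split_off_last_peak\<close> inherits the hypotheses: it agrees with \<open>g\<close> up to the largest remaining
  mode, so the earlier gaps are unchanged, and it decreases after that mode. For \<open>M = {}\<close> the
  monotonicity hypotheses say only that \<open>g\<close> is constant, so the induction starts from one mode.\<close>

lemma sum_of_single_peaks:
  assumes "finite M" "M \<noteq> {}" "continuous_on UNIV g" "\<And>x. 0 \<le> g x"
    and "\<And>x y. x \<le> y \<Longrightarrow> \<forall>m\<in>M. y \<le> m \<Longrightarrow> g x \<le> g y"
    and "\<And>x y. x \<le> y \<Longrightarrow> \<forall>m\<in>M. m \<le> x \<Longrightarrow> g y \<le> g x"
    and "\<And>a b. a \<in> M \<Longrightarrow> b \<in> M \<Longrightarrow> a < b \<Longrightarrow> {a<..<b} \<inter> M = {} \<Longrightarrow> \<exists>D. absorbs_descent g a b D"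
  shows "\<exists>v. (\<forall>m\<in>M. peak_at m (v m)) \<and> (\<forall>x. g x = (\<Sum>m\<in>M. v m x))"
  using assms
proof (induction M arbitrary: g rule: finite_linorder_max_induct)
  case empty
  then show ?case by simp
next
  case (insert b A)
  note hyps = insert.prems
  show ?case
  proof (cases "A = {}")
    case True
    with hyps have "peak_at b g" unfolding peak_at_def by auto
    then show ?thesis using True by (intro exI[of _ "\<lambda>_. g"]) auto
  next
    case False
    define a where "a = Max A"
    have a: "a \<in> A" "\<And>m. m \<in> A \<Longrightarrow> m \<le> a" using \<open>finite A\<close> False by (auto simp: a_def)
    have "a < b" using a insert.hyps by blast
    have "b \<notin> A" using insert.hyps by blast
    have "{a<..<b} \<inter> insert b A = {}" using a(2) by force
    then obtain D where D: "absorbs_descent g a b D"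
      using hyps(6)[of a b] a \<open>a < b\<close> by blast
    have down: "g y \<le> g x" if "b \<le> x" "x \<le> y" for x y
      using that hyps(5)[of x y] insert.hyps by force
    obtain h v where h: "continuous_on UNIV h" "\<And>x. 0 \<le> h x" "\<And>x. x \<le> a \<Longrightarrow> h x = g x"
      "\<And>x y. a \<le> x \<Longrightarrow> x \<le> y \<Longrightarrow> h y \<le> h x" and v: "peak_at b v" and gv: "\<And>x. g x = h x + v x"
      using split_off_last_peak[OF hyps(2,3) \<open>a < b\<close> down D] by metis
    have "\<exists>w. (\<forall>m\<in>A. peak_at m (w m)) \<and> (\<forall>x. h x = (\<Sum>m\<in>A. w m x))"
    proof (rule insert.IH[OF False h(1,2)])
      fix x y assume xy: "x \<le> y" "\<forall>m\<in>A. y \<le> m"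
      then have "y \<le> a" "y \<le> b" using a(1) \<open>a < b\<close> by force+
      then show "h x \<le> h y" using xy h(3) hyps(4)[of x y] by simp
    next
      fix x y assume "x \<le> y" "\<forall>m\<in>A. m \<le> x"
      then show "h y \<le> h x" using a(1) h(4) by blast
    next
      fix c d assume cd: "c \<in> A" "d \<in> A" "c < d" "{c<..<d} \<inter> A = {}"
      have "d < b" using cd insert.hyps by blast
      then have "{c<..<d} \<inter> insert b A = {}" using cd(4) by auto
      then obtain D' where "absorbs_descent g c d D'" using hyps(6)[of c d] cd by blast
      then have "absorbs_descent h c d D'"
        unfolding absorbs_descent_def using h(3) a(2)[OF cd(2)] cd(3) by force
      then show "\<exists>D. absorbs_descent h c d D" by blast
    qed
    then obtain w where w: "\<And>m. m \<in> A \<Longrightarrow> peak_at m (w m)" "\<And>x. h x = (\<Sum>m\<in>A. w m x)"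
      by blast
    have "(\<Sum>m\<in>A. (w(b := v)) m x) = (\<Sum>m\<in>A. w m x)" for x
      using \<open>b \<notin> A\<close> by (intro sum.cong) auto
    then have "g x = (\<Sum>m\<in>insert b A. (w(b := v)) m x)" for x
      using \<open>finite A\<close> \<open>b \<notin> A\<close> by (simp add: gv w(2))
    moreover have "\<forall>m\<in>insert b A. peak_at m ((w(b := v)) m)" using w(1) v \<open>b \<notin> A\<close> by auto
    ultimately show ?thesis by blast
  qed
qed

section \<open>Combinations over subfamilies\<close>

definition lp_combination_on :: "ennreal \<Rightarrow> nat set \<Rightarrow> (nat \<Rightarrow> 'a \<Rightarrow> real) \<Rightarrow> 'a \<Rightarrow> real" where
  "lp_combination_on p S u x =
     (if p = \<infinity> then (MAX i\<in>S. u i x) else (\<Sum>i\<in>S. u i x powr enn2real p) powr (1 / enn2real p))"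

lemma lp_combination_eq_on:
  "n \<noteq> 0 \<Longrightarrow> lp_combination p n u x = lp_combination_on p {..<n} u x"
  by (simp add: lp_combination_def lp_combination_on_def)

lemma enn2real_pos: "0 < p \<Longrightarrow> p \<noteq> \<infinity> \<Longrightarrow> 0 < enn2real p"
  by (simp add: enn2real_positive_iff less_top)

lemma lp_combination_on_nonneg:
  assumes "finite S" "S \<noteq> {}" "\<And>i x. i \<in> S \<Longrightarrow> 0 \<le> u i x"
  shows "0 \<le> lp_combination_on p S u x"
  using assms by (auto simp: lp_combination_on_def Max_ge_iff)

lemma lp_combination_on_mono:
  assumes "finite S" "S \<noteq> {}" "0 < p" "\<And>i. i \<in> S \<Longrightarrow> 0 \<le> u i x \<and> u i x \<le> u i y"
  shows "lp_combination_on p S u x \<le> lp_combination_on p S u y"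
proof (cases "p = \<infinity>")
  case True
  have "u i x \<le> (MAX j\<in>S. u j y)" if "i \<in> S" for i
    using that assms(1,4) by (meson Max_ge finite_imageI imageI order_trans)
  then show ?thesis
    using True assms(1,2) by (simp add: lp_combination_on_def)
next
  case False
  then show ?thesis using assms enn2real_pos[OF assms(3) False]
    by (auto simp: lp_combination_on_def intro!: powr_mono2 sum_mono sum_nonneg)
qed

lemma lp_combination_on_mono_set:
  assumes "finite T" "S \<subseteq> T" "S \<noteq> {}" "0 < p" "\<And>i. i \<in> T \<Longrightarrow> 0 \<le> u i x"
  shows "lp_combination_on p S u x \<le> lp_combination_on p T u x"
proof (cases "p = \<infinity>")
  case True
  then show ?thesis using assms by (auto simp: lp_combination_on_def intro!: Max_mono)
next
  case False
  then show ?thesis using assms enn2real_pos[OF assms(4) False]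
    by (auto simp: lp_combination_on_def intro!: powr_mono2 sum_mono2 sum_nonneg)
qed

lemma continuous_on_Max_image:
  fixes u :: "'i \<Rightarrow> 'a::topological_space \<Rightarrow> 'b::linorder_topology"
  assumes "finite S" "S \<noteq> {}" "\<And>i. i \<in> S \<Longrightarrow> continuous_on A (u i)"
  shows "continuous_on A (\<lambda>x. MAX i\<in>S. u i x)"
  using assms by (induction S rule: finite_ne_induct) (auto intro!: continuous_intros)

lemma continuous_on_lp_combination_on:
  assumes "finite S" "S \<noteq> {}" "0 < p" "\<And>i. i \<in> S \<Longrightarrow> continuous_on A (u i)" "\<And>i x. i \<in> S \<Longrightarrow> 0 \<le> u i x"
  shows "continuous_on A (lp_combination_on p S u)"
proof (cases "p = \<infinity>")
  case True
  then show ?thesis using continuous_on_Max_image[of S A u] assms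
    by (simp add: lp_combination_on_def[abs_def])
next
  case False
  then show ?thesis using assms enn2real_pos[OF assms(3) False]
    by (auto simp: lp_combination_on_def[abs_def]
        intro!: continuous_on_powr_const continuous_on_sum sum_nonneg)
qed

text \<open>Concavity of \<open>x powr r\<close>: an increment by \<open>c\<close> counts less at a larger base point. The
  derivative of the difference of both sides in \<open>c\<close> has the right sign; the case \<open>b = 0\<close> is
  covered because the derivative is only needed at interior points.\<close>

lemma powr_increment_antimono:
  fixes a b c r :: real
  assumes "0 < r" "r \<le> 1" "0 \<le> b" "b \<le> a" "0 \<le> c"
  shows "(a + c) powr r - a powr r \<le> (b + c) powr r - b powr r"
proof -
  define \<phi> where "\<phi> t = (b + t) powr r - (a + t) powr r" for t
  have "\<phi> 0 \<le> \<phi> c"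
  proof (rule DERIV_nonneg_imp_increasing_open[OF \<open>0 \<le> c\<close>])
    fix t assume t: "0 < t" "t < c"
    have "(\<phi> has_real_derivative r * (b + t) powr (r - 1) - r * (a + t) powr (r - 1)) (at t)"
      unfolding \<phi>_def using t assms by (auto intro!: derivative_eq_intros)
    moreover have "(a + t) powr (r - 1) \<le> (b + t) powr (r - 1)"
      using t assms by (intro powr_mono2') auto
    ultimately show "\<exists>y. (\<phi> has_real_derivative y) (at t) \<and> 0 \<le> y"
      using \<open>0 < r\<close> by (intro exI conjI) (auto intro: mult_left_mono)
  next
    show "continuous_on {0..c} \<phi>"
      unfolding \<phi>_def using assms by (intro continuous_intros continuous_on_powr_const) auto
  qed
  then show ?thesis by (simp add: \<phi>_def)
qed

text \<open>If the members of \<open>S\<close> decrease and those of \<open>T\<close> increase from \<open>x\<close> to \<open>y\<close>, then the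
  contribution of \<open>T\<close> on top of \<open>S\<close>, measured in \<open>q\<close>-th powers with \<open>q \<le> p\<close>, increases.\<close>

lemma increment_lp_combination_on_Un_le:
  assumes fin: "finite S" "finite T" "S \<noteq> {}" "T \<noteq> {}" and disj: "S \<inter> T = {}"
    and "0 < p" "0 < q" and q: "p \<noteq> \<infinity> \<Longrightarrow> q \<le> enn2real p"
    and nn: "\<And>i x. i \<in> S \<union> T \<Longrightarrow> 0 \<le> u i x"
    and S: "\<And>i. i \<in> S \<Longrightarrow> u i y \<le> u i x" and T: "\<And>i. i \<in> T \<Longrightarrow> u i x \<le> u i y"
  shows "lp_combination_on p (S \<union> T) u x powr q - lp_combination_on p S u x powr q
       \<le> lp_combination_on p (S \<union> T) u y powr q - lp_combination_on p S u y powr q"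
proof (cases "p = \<infinity>")
  case True
  let ?C = "\<lambda>S z. lp_combination_on p S u z powr q"
  have max_powr: "max s t powr q = max (s powr q) (t powr q)" if "0 \<le> s" "0 \<le> t" for s t
    using that \<open>0 < q\<close> powr_mono2[of q s t] powr_mono2[of q t s] by (auto simp: max_def)
  have nnC: "0 \<le> lp_combination_on p S u z" "0 \<le> lp_combination_on p T u z" for z
    using fin nn by (auto intro!: lp_combination_on_nonneg)
  have "lp_combination_on p (S \<union> T) u z = max (lp_combination_on p S u z) (lp_combination_on p T u z)" for z
    using True fin by (simp add: lp_combination_on_def image_Un Max_Un)
  then have Un: "?C (S \<union> T) z = max (?C S z) (?C T z)" for z
    using max_powr[OF nnC] by simp
  have "?C S y \<le> ?C S x" "?C T x \<le> ?C T y"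
    using fin S T nn nnC \<open>0 < p\<close> \<open>0 < q\<close>
    by (auto intro!: powr_mono2 lp_combination_on_mono)
  then show ?thesis unfolding Un by linarith
next
  case False
  define s where "s = enn2real p"
  have s: "0 < s" "q \<le> s" using enn2real_pos[OF \<open>0 < p\<close> False] q[OF False] by (auto simp: s_def)
  let ?\<Sigma> = "\<lambda>S z. \<Sum>i\<in>S. u i z powr s"
  have C: "lp_combination_on p R u z powr q = ?\<Sigma> R z powr (q / s)" for R z
    using False by (simp add: lp_combination_on_def powr_powr s_def)
  have Un: "?\<Sigma> (S \<union> T) z = ?\<Sigma> S z + ?\<Sigma> T z" for z
    using fin disj by (simp add: sum.union_disjoint)
  have le: "?\<Sigma> S y \<le> ?\<Sigma> S x" "?\<Sigma> T x \<le> ?\<Sigma> T y"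
    using S T nn s by (auto intro!: sum_mono powr_mono2)
  have nn\<Sigma>: "0 \<le> ?\<Sigma> R z" for R z by (simp add: sum_nonneg)
  have "(?\<Sigma> S x + ?\<Sigma> T x) powr (q / s) - ?\<Sigma> S x powr (q / s)
      \<le> (?\<Sigma> S y + ?\<Sigma> T x) powr (q / s) - ?\<Sigma> S y powr (q / s)"
    using s \<open>0 < q\<close> le nn\<Sigma> by (intro powr_increment_antimono) auto
  also have "\<dots> \<le> (?\<Sigma> S y + ?\<Sigma> T y) powr (q / s) - ?\<Sigma> S y powr (q / s)"
    using s \<open>0 < q\<close> le nn\<Sigma> by (intro diff_right_mono powr_mono2) (auto intro: add_nonneg_nonneg)
  finally show ?thesis unfolding C Un .
qed

section \<open>From one exponent to a smaller one\<close>

text \<open>A sum of peaks is turned into a \<open>p\<close>-combination of unimodal functions by taking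
  \<open>p\<close>-th roots. Vanishing peaks are not unimodal and have to be dropped.\<close>

lemma ucat_le_card_of_peaks:
  assumes "finite M" "0 < p" "p \<noteq> \<infinity>" "\<And>x. 0 \<le> f x"
    and v: "\<And>m. m \<in> M \<Longrightarrow> peak_at m (v m)"
    and f: "\<And>x. f x powr enn2real p = (\<Sum>m\<in>M. v m x)"
  shows "ucat p f \<le> enat (card M)"
proof -
  define q where "q = enn2real p"
  have q: "0 < q" using enn2real_pos assms by (simp add: q_def)
  define M' where "M' = {m \<in> M. 0 < v m m}"
  have finM': "finite M'" using \<open>finite M\<close> by (simp add: M'_def)
  have zero: "v m x = 0" if "m \<in> M - M'" for m x
  proof -
    have p: "peak_at m (v m)" and "v m m \<le> 0" using that v by (auto simp: M'_def)
    moreover have "v m x \<le> v m m" "0 \<le> v m x"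
      using p unfolding peak_at_def by (meson linear order_refl)+
    ultimately show ?thesis by linarith
  qed
  have f': "f x powr q = (\<Sum>m\<in>M'. v m x)" for x
    unfolding q_def f using \<open>finite M\<close> zero by (intro sum.mono_neutral_right) (auto simp: M'_def)
  define n where "n = card M'"
  obtain e where e: "bij_betw e {..<n} M'"
    using ex_bij_betw_nat_finite[OF finM'] by (auto simp: n_def atLeast0LessThan)
  define u where "u i x = v (e i) x powr (1 / q)" for i x
  have nnv: "0 \<le> v m x" if "m \<in> M" for m x using v[OF that] unfolding peak_at_def by blast
  have eM': "e i \<in> M'" if "i < n" for i using e that by (auto simp: bij_betw_def)
  then have eM: "e i \<in> M" if "i < n" for i using that by (auto simp: M'_def)
  have uni: "unimodal (u i)" if "i < n" for i
  proof (rule peak_at_imp_unimodal)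
    show "peak_at (e i) (u i)"
      unfolding u_def using v[OF eM[OF that]] q by (intro peak_at_powr) auto
    show "0 < u i (e i)" using eM'[OF that] by (simp add: u_def M'_def)
  qed
  have "f x = lp_combination p n u x" for x
  proof -
    have "(\<Sum>m\<in>M'. v m x) = (\<Sum>i<n. v (e i) x)"
      using sum.reindex_bij_betw[OF e, of "\<lambda>m. v m x"] by simp
    also have "\<dots> = (\<Sum>i<n. u i x powr q)"
      using q nnv eM by (intro sum.cong) (auto simp: u_def powr_powr)
    finally have eq: "f x powr q = (\<Sum>i<n. u i x powr q)" by (simp add: f')
    have "f x = (f x powr q) powr (1 / q)" using q assms(4) by (simp add: powr_powr)
    then show ?thesis
      using eq \<open>p \<noteq> \<infinity>\<close> by (auto simp: lp_combination_def q_def)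
  qed
  then have "ucat p f \<le> enat n"
    unfolding ucat_def using uni by (intro Inf_lower) blast
  also have "\<dots> \<le> enat (card M)" using \<open>finite M\<close> by (auto simp: n_def M'_def intro: card_mono)
  finally show ?thesis .
qed

lemma ucat_le_of_lp_combination:
  fixes f :: "real \<Rightarrow> real" and p1 p2 :: ennreal
  assumes "0 < p1" "p1 < p2"
    and uni: "\<And>i. i < n \<Longrightarrow> unimodal (u i)" and f: "\<And>x. f x = lp_combination p2 n u x"
  shows "ucat p1 f \<le> enat n"
proof (cases "n = 0")
  case True
  then have "f x = lp_combination p1 0 u x" for x by (simp add: f lp_combination_def)
  then show ?thesis unfolding ucat_def True by (intro Inf_lower) auto
next
  case False
  define q where "q = enn2real p1"
  have fin1: "p1 \<noteq> \<infinity>" using \<open>p1 < p2\<close> by auto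
  have q: "0 < q" using enn2real_pos \<open>0 < p1\<close> fin1 by (simp add: q_def)
  have qle: "q \<le> enn2real p2" if "p2 \<noteq> \<infinity>"
    unfolding q_def using that \<open>p1 < p2\<close> by (intro enn2real_mono) (auto simp: less_top)
  have "0 < p2" using assms by simp
  have "\<exists>m. peak_at m (u i)" if "i < n" for i using unimodal_imp_peak_at[OF uni[OF that]] by blast
  then obtain \<mu> where \<mu>: "\<And>i. i < n \<Longrightarrow> peak_at (\<mu> i) (u i)" by metis
  have nn: "\<And>i x. i < n \<Longrightarrow> 0 \<le> u i x"
    and cont: "\<And>i. i < n \<Longrightarrow> continuous_on UNIV (u i)"
    and up: "\<And>i x y. i < n \<Longrightarrow> x \<le> y \<Longrightarrow> y \<le> \<mu> i \<Longrightarrow> u i x \<le> u i y"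
    and down: "\<And>i x y. i < n \<Longrightarrow> \<mu> i \<le> x \<Longrightarrow> x \<le> y \<Longrightarrow> u i y \<le> u i x"
    using \<mu> unfolding peak_at_def by blast+
  let ?C = "\<lambda>S. lp_combination_on p2 S u"
  let ?N = "{..<n}"
  have fC: "f x = ?C ?N x" for x using False by (simp add: f lp_combination_eq_on)
  have N: "finite ?N" "?N \<noteq> {}" using False by auto
  have nnC: "0 \<le> ?C S x" if "S \<subseteq> ?N" "S \<noteq> {}" for S x
    using that nn by (intro lp_combination_on_nonneg) (auto intro: finite_subset)
  have contC: "continuous_on UNIV (\<lambda>x. ?C S x powr q)" if "S \<subseteq> ?N" "S \<noteq> {}" for S
    using that nn cont q nnC[OF that] \<open>0 < p2\<close>
    by (intro continuous_on_powr_const continuous_on_lp_combination_on) (auto intro: finite_subset)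
  have monoC: "?C S x powr q \<le> ?C S y powr q"
    if "S \<subseteq> ?N" "S \<noteq> {}" "\<And>i. i \<in> S \<Longrightarrow> u i x \<le> u i y" for S x y
    using that nn q nnC \<open>0 < p2\<close>
    by (intro powr_mono2 lp_combination_on_mono) (auto intro: finite_subset)
  define M where "M = \<mu> ` ?N"
  have M: "finite M" "M \<noteq> {}" "card M \<le> n" using N card_image_le[of ?N \<mu>] by (auto simp: M_def)
  define g where "g x = ?C ?N x powr q" for x
  have "\<exists>v. (\<forall>m\<in>M. peak_at m (v m)) \<and> (\<forall>x. g x = (\<Sum>m\<in>M. v m x))"
  proof (rule sum_of_single_peaks[OF M(1,2)])
    show "continuous_on UNIV g" unfolding g_def using contC N by blast
    show "0 \<le> g x" for x by (simp add: g_def)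
    show "g x \<le> g y" if "x \<le> y" "\<forall>m\<in>M. y \<le> m" for x y
      unfolding g_def using that up N by (intro monoC) (auto simp: M_def)
    show "g y \<le> g x" if "x \<le> y" "\<forall>m\<in>M. m \<le> x" for x y
      unfolding g_def using that down N by (intro monoC) (auto simp: M_def)
  next
    fix a b assume ab: "a \<in> M" "b \<in> M" "a < b" "{a<..<b} \<inter> M = {}"
    define S where "S = {i \<in> ?N. \<mu> i \<le> a}"
    define T where "T = {i \<in> ?N. b \<le> \<mu> i}"
    have "\<mu> i \<le> a \<or> b \<le> \<mu> i" if "i < n" for i
      using ab(4) that by (force simp: M_def)
    then have ST: "S \<union> T = ?N" by (auto simp: S_def T_def)
    have sets: "finite S" "finite T" "S \<noteq> {}" "T \<noteq> {}" "S \<inter> T = {}"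
      using ab(1-3) by (auto simp: S_def T_def M_def)
    have SN: "S \<subseteq> ?N" by (auto simp: S_def)
    have "absorbs_descent g a b (\<lambda>x. ?C S x powr q)"
      unfolding absorbs_descent_def
    proof (intro conjI allI impI)
      show "continuous_on UNIV (\<lambda>x. ?C S x powr q)" using contC SN sets(3) by blast
      show "?C S a powr q \<le> g a"
        unfolding g_def using SN sets nn q nnC \<open>0 < p2\<close>
        by (intro powr_mono2 lp_combination_on_mono_set) auto
      fix x y assume xy: "a \<le> x \<and> x \<le> y \<and> y \<le> b"
      have Sd: "u i y \<le> u i x" if "i \<in> S" for i using that xy by (auto simp: S_def intro!: down)
      have Tu: "u i x \<le> u i y" if "i \<in> T" for i using that xy by (auto simp: T_def intro!: up)
      show "?C S y powr q \<le> ?C S x powr q" using SN sets(3) Sd by (rule monoC)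
      have "?C (S \<union> T) x powr q - ?C S x powr q \<le> ?C (S \<union> T) y powr q - ?C S y powr q"
        using sets \<open>0 < p2\<close> q qle nn ST Sd Tu
        by (intro increment_lp_combination_on_Un_le) auto
      then show "g x - ?C S x powr q \<le> g y - ?C S y powr q" by (simp add: g_def ST)
    qed simp
    then show "\<exists>D. absorbs_descent g a b D" by blast
  qed
  then obtain v where v: "\<And>m. m \<in> M \<Longrightarrow> peak_at m (v m)" "\<And>x. g x = (\<Sum>m\<in>M. v m x)"
    by blast
  have "ucat p1 f \<le> enat (card M)"
  proof (rule ucat_le_card_of_peaks[OF M(1) \<open>0 < p1\<close> fin1 _ v(1)])
    show "0 \<le> f x" for x unfolding fC using nnC N(2) by blast
    show "f x powr enn2real p1 = (\<Sum>m\<in>M. v m x)" for x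
      using v(2)[of x] by (simp add: g_def fC q_def)
  qed
  then show ?thesis using M(3) by (meson enat_ord_simps(1) order_trans)
qed

theorem theorem4p5:
  fixes f :: "real \<Rightarrow> real" and p1 p2 :: ennreal
  assumes "\<And>x. 0 \<le> f x"
    and "continuous_on UNIV f"
    and "bounded_variation f"
    and "0 < p1" and "p1 < p2"
  shows "ucat p1 f \<le> ucat p2 f"
  unfolding ucat_def[of p2]
  using ucat_le_of_lp_combination[OF assms(4,5)] by (intro Inf_greatest) auto

end
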